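(* Let $\ell \ge 2$ be an integer, let $n \in \mathbb{N}$, and let $q \in \mathbb{R}^+$ be defined by $n = 2(q^\ell + q^{\ell-1} + \dots + 1)$. Then $\mathrm{z}(n, \mathcal{C}_{2\ell}) \le \frac12 (q+1) n$.
   Context: Graphs are finite and simple. $C_j$ denotes the cycle of length $j$, and $\mathcal{C}_{2\ell} = \{C_4, C_6, \dots, C_{2\ell}\}$. A graph is $\mathcal{F}$-free if it contains no member of the family $\mathcal{F}$ as a (not necessarily induced) subgraph. $\mathrm{z}(n,\mathcal{F})$ is the maximum number of edges in an $\mathcal{F}$-free bipartite graph on $n$ vertices. $\mathbb{R}^+$ is the set of positive reals. *)

theory Defs
  imports Complex_Main "Graph_Theory.Graph_Theory"
begin

text \<open>
  A finite simple graph is a \<^locale>\<open>pair_graph\<close>: a finite digraph without loops or parallel arcs whose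
  arc relation is symmetric.  An undirected edge is thus represented by two opposite arcs, so edges
  are counted as unordered pairs of endpoints.
\<close>

definition edges :: "'a pair_pre_digraph \<Rightarrow> 'a set set" where
  "edges G = (\<lambda>(u, v). {u, v}) ` parcs G"

definition bipartite :: "'a pair_pre_digraph \<Rightarrow> bool" where
  "bipartite G \<longleftrightarrow>
     (\<exists>U W. pverts G = U \<union> W \<and> U \<inter> W = {} \<and> parcs G \<subseteq> U \<times> W \<union> W \<times> U)"

definition cycle_graph :: "nat \<Rightarrow> nat pair_pre_digraph" where
  "cycle_graph j = \<lparr> pverts = {..<j},
     parcs = {(u, v). u < j \<and> v < j \<and> (v = Suc u mod j \<or> u = Suc v mod j)} \<rparr>"

definition even_cycles :: "nat \<Rightarrow> nat pair_pre_digraph set" where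
  "even_cycles l = (\<lambda>k. cycle_graph (2 * k)) ` {2..l}"

definition contains_graph :: "'a pair_pre_digraph \<Rightarrow> 'b pair_pre_digraph \<Rightarrow> bool" where
  "contains_graph G H \<longleftrightarrow>
     (\<exists>K :: 'a pair_pre_digraph. subgraph (with_proj K) (with_proj G)
        \<and> digraph_iso (with_proj H) (with_proj K))"

definition family_free :: "'b pair_pre_digraph set \<Rightarrow> 'a pair_pre_digraph \<Rightarrow> bool" where
  "family_free F G \<longleftrightarrow> (\<forall>H \<in> F. \<not> contains_graph G H)"

text \<open>
  Every finite graph is isomorphic to one whose vertices are natural numbers, so it suffices to
  range over those.
\<close>

definition zarankiewicz_sizes :: "nat \<Rightarrow> 'b pair_pre_digraph set \<Rightarrow> nat set" where
  "zarankiewicz_sizes n F = {card (edges G) | G :: nat pair_pre_digraph.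
     pair_graph G \<and> card (pverts G) = n \<and> bipartite G \<and> family_free F G}"

definition zarankiewicz :: "nat \<Rightarrow> 'b pair_pre_digraph set \<Rightarrow> nat" where
  "zarankiewicz n F = Max (zarankiewicz_sizes n F)"

lemma pair_graph_cycle_graph:
  assumes "j \<ge> 3"
  shows "pair_graph (cycle_graph j)"
proof
  show "finite (parcs (cycle_graph j))"
    by (rule finite_subset[of _ "{..<j} \<times> {..<j}"]) (auto simp: cycle_graph_def)
  show "symmetric (with_proj (cycle_graph j))"
    by (auto simp: symmetric_def cycle_graph_def sym_def)
  show "fst e \<noteq> snd e" if "e \<in> parcs (cycle_graph j)" for e
    using that assms by (auto simp: cycle_graph_def mod_Suc split: if_splits)
qed (auto simp: cycle_graph_def)

lemma contains_graph_iff: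
  assumes "pair_graph G" "pair_graph H"
  shows "contains_graph G H \<longleftrightarrow>
    (\<exists>f. inj_on f (pverts H) \<and> f ` pverts H \<subseteq> pverts G \<and>
       (\<forall>(u, v) \<in> parcs H. (f u, f v) \<in> parcs G))" (is "?L \<longleftrightarrow> ?R")
proof -
  interpret G: pair_graph G by fact
  interpret H: pair_graph H by fact
  show ?thesis
  proof
    assume ?L
    then obtain K :: "'a pair_pre_digraph" and h where
      K: "subgraph (with_proj K) (with_proj G)"
      and h: "pre_digraph.digraph_isomorphism (with_proj H) h"
      and eq: "with_proj K = app_iso h (with_proj H)"
      by (auto simp: contains_graph_def digraph_iso_def)
    have v: "pverts K = iso_verts h ` pverts H" and a: "parcs K = iso_arcs h ` parcs H"
      and t: "iso_tail h = fst" and hd: "iso_head h = snd"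
      using arg_cong[OF eq, of verts] arg_cong[OF eq, of arcs]
        arg_cong[OF eq, of tail] arg_cong[OF eq, of head]
      by (auto simp: app_iso_def)
    have "(iso_verts h u, iso_verts h w) \<in> parcs G" if "(u, w) \<in> parcs H" for u w
    proof -
      have "iso_arcs h (u, w) = (iso_verts h u, iso_verts h w)"
        using h that t hd by (fastforce simp: pre_digraph.digraph_isomorphism_def prod_eq_iff)
      moreover have "iso_arcs h (u, w) \<in> parcs K" using that a by auto
      ultimately show ?thesis using K by (auto simp: subgraph_def)
    qed
    moreover have "iso_verts h ` pverts H \<subseteq> pverts G" using K v by (auto simp: subgraph_def)
    moreover have "inj_on (iso_verts h) (pverts H)"
      using h by (auto simp: pre_digraph.digraph_isomorphism_def)
    ultimately show ?R by (intro exI[of _ "iso_verts h"]) auto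
  next
    assume ?R
    then obtain f where f: "inj_on f (pverts H)" "f ` pverts H \<subseteq> pverts G"
      and "\<forall>(u, v) \<in> parcs H. (f u, f v) \<in> parcs G" by (elim exE conjE)
    then have f3: "(f u, f v) \<in> parcs G" if "(u, v) \<in> parcs H" for u v using that by auto
    define h where "h = \<lparr> iso_verts = f, iso_arcs = map_prod f f,
      iso_head = snd, iso_tail = fst \<rparr>"
    define K where "K = \<lparr> pverts = f ` pverts H, parcs = map_prod f f ` parcs H \<rparr>"
    have "inj_on (map_prod f f) (parcs H)"
    proof (rule inj_on_subset)
      show "inj_on (map_prod f f) (pverts H \<times> pverts H)"
        using f(1) by (auto simp: inj_on_def)
      show "parcs H \<subseteq> pverts H \<times> pverts H"
        by (auto dest: H.in_arcsD1 H.in_arcsD2)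
    qed
    then have "pre_digraph.digraph_isomorphism (with_proj H) h"
      using f(1) H.wf_digraph by (simp add: pre_digraph.digraph_isomorphism_def h_def)
    moreover have "with_proj K = app_iso h (with_proj H)"
      by (simp add: K_def h_def app_iso_def with_proj_def)
    moreover have "subgraph (with_proj K) (with_proj G)"
    proof -
      have "pair_wf_digraph K"
        by unfold_locales (auto simp: K_def dest: H.in_arcsD1 H.in_arcsD2)
      then have "wf_digraph (with_proj K)"
        by (simp add: wf_digraph_def pair_wf_digraph_def)
      moreover have "parcs K \<subseteq> parcs G" using f3 by (auto simp: K_def)
      moreover have "pverts K \<subseteq> pverts G" using f(2) by (simp add: K_def)
      ultimately show ?thesis
        using G.wf_digraph by (simp add: subgraph_def compatible_def)
    qed
    ultimately show ?L unfolding contains_graph_def digraph_iso_def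
      by (intro exI[of _ K] conjI exI[of _ h])
  qed
qed

lemma finite_zarankiewicz_sizes: "finite (zarankiewicz_sizes n F)"
proof (rule finite_subset)
  show "zarankiewicz_sizes n F \<subseteq> {..2 ^ n}"
  proof
    fix m assume "m \<in> zarankiewicz_sizes n F"
    then obtain G :: "nat pair_pre_digraph" where G: "pair_graph G" "card (pverts G) = n"
      and m: "m = card (edges G)" by (auto simp: zarankiewicz_sizes_def)
    interpret pair_graph G by fact
    have "edges G \<subseteq> Pow (pverts G)"
      by (auto simp: edges_def dest: in_arcsD1 in_arcsD2)
    then have "card (edges G) \<le> card (Pow (pverts G))"
      by (intro card_mono) (auto simp: pair_finite_verts)
    then show "m \<in> {..2 ^ n}" using G m by (simp add: card_Pow pair_finite_verts)
  qed
qed simp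

text \<open>The maximum defining \<^const>\<open>zarankiewicz\<close> is attained for \<^const>\<open>even_cycles\<close>: the
  edgeless graph on \<open>n\<close> vertices is admissible.\<close>

lemma zarankiewicz_sizes_even_cycles_nonempty: "zarankiewicz_sizes n (even_cycles l) \<noteq> {}"
proof -
  define G :: "nat pair_pre_digraph" where "G = \<lparr> pverts = {..<n}, parcs = {} \<rparr>"
  have "pair_graph G"
    by standard (auto simp: G_def symmetric_def sym_def)
  moreover have "bipartite G" by (auto simp: bipartite_def G_def)
  moreover have "\<not> contains_graph G (cycle_graph (2 * k))" if "k \<ge> 2" for k
  proof -
    have "(0, 1) \<in> parcs (cycle_graph (2 * k))" using that by (auto simp: cycle_graph_def)
    moreover have "pair_graph (cycle_graph (2 * k))"
      using that by (intro pair_graph_cycle_graph) simp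
    ultimately show ?thesis
      using contains_graph_iff[OF \<open>pair_graph G\<close>] by (fastforce simp: G_def)
  qed
  ultimately show ?thesis
    by (auto simp: zarankiewicz_sizes_def family_free_def even_cycles_def G_def intro!: exI[of _ G])
qed

end

theory Submission
  imports Defs "HOL-Analysis.Convex"
begin

text \<open>
  This is the irregular Moore bound of Alon, Hoory and Linial: a graph with \<open>n\<close> vertices, average
  degree \<open>d \<ge> 2\<close> and girth at least \<open>2 * l + 2\<close> satisfies \<open>n \<ge> 2 * (\<Sum>i\<le>l. (d - 1) ^ i)\<close>.
  Deleting a vertex of degree at most one does not decrease \<open>d\<close>, so all degrees may be taken to be at
  least two. The ends of the non-backtracking walks of length at most \<open>l\<close> leaving a given edge in either
  direction are pairwise distinct. The uniform distribution on arcs is stationary for the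
  non-backtracking random walk, so by concavity of \<open>ln\<close> the mean over all arcs of the logarithm of the
  number of \<open>i\<close>-step continuations is at least \<open>i\<close> times the mean of \<open>ln (deg - 1)\<close>, which is at least
  \<open>ln (d - 1)\<close> because \<open>x * ln (x - 1)\<close> is convex on \<open>[2, \<infinity>)\<close>.
  If \<open>d < 2\<close>, there are at most \<open>n - 1\<close> edges and the geometric sum gives \<open>n * (1 - q) \<le> 2\<close>.
\<close>

section \<open>Non-backtracking walks in a graph of large girth\<close>

fun nb_walk :: "('a \<times> 'a) set \<Rightarrow> 'a list \<Rightarrow> bool" where
  "nb_walk R (x # y # z # xs) \<longleftrightarrow> (x, y) \<in> R \<and> x \<noteq> z \<and> nb_walk R (y # z # xs)"
| "nb_walk R [x, y] \<longleftrightarrow> (x, y) \<in> R"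
| "nb_walk R _ \<longleftrightarrow> True"

text \<open>For symmetric irreflexive \<open>R\<close>, this excludes cycles of length at most
  \<open>m\<close>. The lower bound 3 keeps an arc and its reverse from counting as a cycle.\<close>

definition girth_gt :: "('a \<times> 'a) set \<Rightarrow> nat \<Rightarrow> bool" where
  "girth_gt R m \<longleftrightarrow> (\<forall>xs. distinct xs \<longrightarrow> 3 \<le> length xs \<longrightarrow> length xs \<le> m \<longrightarrow>
     successively (\<lambda>x y. (x, y) \<in> R) xs \<longrightarrow> (last xs, hd xs) \<notin> R)"

lemma nb_walk_tl: "nb_walk R (x # xs) \<Longrightarrow> nb_walk R xs"
  by (cases "(R, x # xs)" rule: nb_walk.cases) auto

lemma nb_walk_successively: "nb_walk R xs \<Longrightarrow> successively (\<lambda>x y. (x, y) \<in> R) xs"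
  by (induction R xs rule: nb_walk.induct) auto

text \<open>The only new triple of consecutive vertices is \<open>x\<close>, \<open>a\<close>,
  \<open>y\<close>, hence the condition \<open>x \<noteq> y\<close>.\<close>

lemma nb_walk_join:
  assumes "nb_walk R (xs @ [x, a])" "nb_walk R (a # y # ys)" "x \<noteq> y"
  shows "nb_walk R (xs @ x # a # y # ys)"
  using assms
proof (induction xs)
  case (Cons b xs)
  then show ?case by (cases xs rule: list.exhaust[case_product list.exhaust]; cases "tl xs") auto
qed simp

lemma nb_walk_rev:
  assumes "sym R" "nb_walk R xs"
  shows "nb_walk R (rev xs)"
  using assms(2,1)
  by (induction R xs rule: nb_walk.induct) (auto intro!: nb_walk_join dest: symD)

text \<open>A repetition would close a cycle. Irreflexivity and non-backtracking exclude a return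
  after one or two steps, so the cycle has at least 3 vertices; it has at most \<open>m\<close>
  because the second occurrence of \<open>x\<close> is not counted.\<close>

lemma nb_walk_distinct:
  assumes "girth_gt R m" "irrefl R" "nb_walk R xs" "length xs \<le> Suc m"
  shows "distinct xs"
  using assms(3,4)
proof (induction xs)
  case (Cons x ys)
  have ys: "distinct ys" using Cons by (auto dest: nb_walk_tl)
  have "x \<notin> set ys"
  proof
    assume "x \<in> set ys"
    then obtain as bs where eq: "ys = as @ x # bs" by (meson split_list)
    have "successively (\<lambda>x y. (x, y) \<in> R) ((x # as) @ x # bs)"
      using nb_walk_successively[OF Cons.prems(1)] eq by simp
    then have s: "successively (\<lambda>x y. (x, y) \<in> R) (x # as)" "(last (x # as), x) \<in> R"
      unfolding successively_append_iff by auto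
    have "as \<noteq> []" using s(2) assms(2) by (auto dest: irreflD)
    moreover have "as \<noteq> [a]" for a using Cons.prems(1) eq by auto
    ultimately have "3 \<le> length (x # as)"
      by (cases as rule: remdups_adj.cases) auto
    moreover have "distinct (x # as)" "length (x # as) \<le> m" using ys eq Cons.prems(2) by auto
    ultimately show False using assms(1) s unfolding girth_gt_def by (metis list.sel(1))
  qed
  then show ?case using ys by simp
qed simp

text \<open>Where two walks diverge, reversing one and joining it to the other gives a
  non-backtracking walk on at most \<open>Suc m\<close> vertices. Its two ends agree, against
  \<open>nb_walk_distinct\<close>.\<close>

lemma nb_walk_unique:
  assumes "girth_gt R m" "irrefl R" "sym R"
  shows "\<lbrakk>nb_walk R (x # xs); nb_walk R (x # ys); last (x # xs) = last (x # ys);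
    length xs + length ys \<le> m\<rbrakk> \<Longrightarrow> xs = ys"
proof (induction xs arbitrary: x ys)
  case Nil
  have "distinct (x # ys)" using Nil by (intro nb_walk_distinct[OF assms(1,2)]) auto
  then show ?case using Nil by (cases ys rule: rev_cases) auto
next
  case (Cons a as)
  show ?case
  proof (cases ys)
    case Nil
    have "distinct (x # a # as)"
      using Cons.prems Nil nb_walk_distinct[OF assms(1,2) Cons.prems(1)] by auto
    then show ?thesis using Cons.prems(3) Nil
      by (metis last.simps last_in_set distinct.simps(2) list.discI)
  next
    case ys: (Cons b bs)
    show ?thesis
    proof (cases "a = b")
      case True
      then show ?thesis using Cons.IH[of a bs] Cons.prems ys by (auto dest: nb_walk_tl)
    next
      case False
      have "nb_walk R (rev as @ [a, x])"
        using nb_walk_rev[OF assms(3) Cons.prems(1)] by simp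
      then have "nb_walk R (rev as @ a # x # b # bs)"
        using False Cons.prems(2) ys by (intro nb_walk_join) auto
      then have "distinct (rev as @ a # x # b # bs)"
        using Cons.prems(4) ys by (intro nb_walk_distinct[OF assms(1,2)]) auto
      then have "set (a # as) \<inter> set (b # bs) = {}" by auto
      moreover have "last (a # as) = last (b # bs)" using Cons.prems(3) ys by simp
      ultimately show ?thesis by (metis disjoint_iff last_in_set list.discI)
    qed
  qed
qed

section \<open>Counting the continuations of an arc\<close>

definition extensions :: "('a \<times> 'a) set \<Rightarrow> nat \<Rightarrow> 'a \<Rightarrow> 'a \<Rightarrow> 'a list set" where
  "extensions R i u v = {xs. length xs = i \<and> nb_walk R (u # v # xs)}"

definition num_ext :: "('a \<times> 'a) set \<Rightarrow> nat \<Rightarrow> 'a \<Rightarrow> 'a \<Rightarrow> real" where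
  "num_ext R i u v = real (card (extensions R i u v))"

lemma extensions_0: "(u, v) \<in> R \<Longrightarrow> extensions R 0 u v = {[]}"
  by (auto simp: extensions_def)

lemma extensions_Suc:
  "(u, v) \<in> R \<Longrightarrow> extensions R (Suc i) u v = (\<Union>w\<in>R `` {v} - {u}. (#) w ` extensions R i v w)"
proof -
  have "(v, w) \<in> R" if "nb_walk R (v # w # xs)" for w xs
    using that by (cases xs) auto
  then show "(u, v) \<in> R \<Longrightarrow> ?thesis"
    by (fastforce simp: extensions_def length_Suc_conv)
qed

text \<open>\<open>R\<close> holds both orientations of every edge, so
  \<open>card R / card V\<close> is the average degree.\<close>

locale finite_graph =
  fixes V :: "'a set" and R :: "('a \<times> 'a) set"
  assumes finV: "finite V" and RV: "R \<subseteq> V \<times> V" and symR: "sym R" and irreflR: "irrefl R"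
begin

abbreviation deg :: "'a \<Rightarrow> nat" where "deg v \<equiv> card (R `` {v})"

lemma finR: "finite R"
  using finV RV by (auto intro: finite_subset)

lemma fin_nbrs: "finite (R `` {v})"
  using finR by (rule finite_Image)

lemma fin_extensions: "(u, v) \<in> R \<Longrightarrow> finite (extensions R i u v)"
proof (induction i arbitrary: u v)
  case (Suc i)
  then show ?case using fin_nbrs by (auto simp: extensions_Suc)
qed (simp add: extensions_0)

lemma num_ext_0: "(u, v) \<in> R \<Longrightarrow> num_ext R 0 u v = 1"
  by (simp add: num_ext_def extensions_0)

lemma num_ext_Suc:
  assumes "(u, v) \<in> R"
  shows "num_ext R (Suc i) u v = (\<Sum>w\<in>R `` {v} - {u}. num_ext R i v w)"
proof -
  have "card (extensions R (Suc i) u v) =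
    (\<Sum>w\<in>R `` {v} - {u}. card ((#) w ` extensions R i v w))"
    unfolding extensions_Suc[OF assms]
    by (rule card_UN_disjoint) (use fin_nbrs fin_extensions in auto)
  then show ?thesis by (simp add: num_ext_def card_image)
qed

lemma sum_num_ext_le:
  assumes g: "girth_gt R (2 * l + 1)" and uv: "(u, v) \<in> R"
  shows "(\<Sum>i\<le>l. num_ext R i u v) + (\<Sum>i\<le>l. num_ext R i v u) \<le> real (card V)"
proof -
  have vu: "(v, u) \<in> R" using uv symR by (auto dest: symD)
  define A where "A u v = (\<Union>i\<le>l. extensions R i u v)" for u v
  have A: "xs \<in> A u v \<longleftrightarrow> length xs \<le> l \<and> nb_walk R (u # v # xs)" for xs u v
    by (auto simp: A_def extensions_def)
  have cA: "real (card (A u v)) = (\<Sum>i\<le>l. num_ext R i u v)" if "(u, v) \<in> R" for u v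
  proof -
    have "card (A u v) = (\<Sum>i\<le>l. card (extensions R i u v))"
      unfolding A_def by (rule card_UN_disjoint)
        (use fin_extensions[OF that] in \<open>auto simp: extensions_def\<close>)
    then show ?thesis by (simp add: num_ext_def)
  qed
  have finA: "finite (A u v)" if "(u, v) \<in> R" for u v
    using fin_extensions[OF that] by (auto simp: A_def)
  have inj: "inj_on (\<lambda>xs. last (v # xs)) (A u v)" for u v
    by (intro inj_onI nb_walk_unique[OF g irreflR symR]) (auto simp: A dest: nb_walk_tl)
  \<comment> \<open>Both walks are read as starting at \<open>v\<close>, the second one passing
    through \<open>u\<close>. They have at most \<open>l\<close> and \<open>l + 1\<close> steps,
    which is where \<open>2 * l + 1\<close> comes from. Uniqueness forces the first walk to
    backtrack to \<open>u\<close>.\<close>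
  have "(\<lambda>xs. last (v # xs)) ` A u v \<inter> (\<lambda>xs. last (u # xs)) ` A v u = {}"
  proof (intro equals0I)
    fix x assume "x \<in> (\<lambda>xs. last (v # xs)) ` A u v \<inter> (\<lambda>xs. last (u # xs)) ` A v u"
    then obtain xs ys where xs: "xs \<in> A u v" and ys: "ys \<in> A v u"
      and eq: "last (v # xs) = last (v # u # ys)" by auto
    have "xs = u # ys"
      using xs ys eq by (intro nb_walk_unique[OF g irreflR symR]) (auto simp: A dest: nb_walk_tl)
    then show False using xs by (auto simp: A)
  qed
  then have "card ((\<lambda>xs. last (v # xs)) ` A u v) + card ((\<lambda>xs. last (u # xs)) ` A v u) =
    card ((\<lambda>xs. last (v # xs)) ` A u v \<union> (\<lambda>xs. last (u # xs)) ` A v u)"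
    using finA[OF uv] finA[OF vu] by (subst card_Un_disjoint) auto
  also have "\<dots> \<le> card V"
  proof (intro card_mono finV)
    have last_V: "last (v # xs) \<in> V" if "v \<in> V" "nb_walk R (u # v # xs)" for u v xs
      using that
    proof (induction xs arbitrary: u v)
      case (Cons a xs)
      then have "nb_walk R (v # a # xs)" by (auto dest: nb_walk_tl)
      then show ?case using Cons.IH[of a v] nb_walk_successively[of R "v # a # xs"] RV by auto
    qed simp
    then show "(\<lambda>xs. last (v # xs)) ` A u v \<union> (\<lambda>xs. last (u # xs)) ` A v u \<subseteq> V"
      using uv RV by (auto simp: A simp del: last.simps intro: last_V[of _ u] last_V[of _ v])
  qed
  finally have "card (A u v) + card (A v u) \<le> card V" using inj by (simp add: card_image del: last.simps)
  then show ?thesis using cA[OF uv] cA[OF vu] by simp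
qed

text \<open>Both sides sum over the two-step walks \<open>u\<close>, \<open>v\<close>, \<open>w\<close> with \<open>u \<noteq> w\<close>: this is the stationarity of
  the uniform distribution on arcs.\<close>

lemma sum_steps:
  "(\<Sum>(u, v)\<in>R. \<Sum>w\<in>R `` {v} - {u}. f v w) = (\<Sum>(v, w)\<in>R. \<Sum>u\<in>R `` {v} - {w}. f v w)"
proof -
  have "(\<Sum>(u, v)\<in>R. \<Sum>w\<in>R `` {v} - {u}. f v w) =
    (\<Sum>(e, w)\<in>Sigma R (\<lambda>(u, v). R `` {v} - {u}). f (snd e) w)"
    using finR fin_nbrs by (subst sum.Sigma[symmetric]) (auto simp: case_prod_unfold)
  also have "\<dots> = (\<Sum>(e, u)\<in>Sigma R (\<lambda>(v, w). R `` {v} - {w}). f (fst e) (snd e))"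
    by (rule sum.reindex_bij_witness[where i = "\<lambda>((v, w), u). ((u, v), w)"
          and j = "\<lambda>((u, v), w). ((v, w), u)"]) (use symR in \<open>auto dest: symD\<close>)
  also have "\<dots> = (\<Sum>(v, w)\<in>R. \<Sum>u\<in>R `` {v} - {w}. f v w)"
    using finR fin_nbrs by (subst sum.Sigma[symmetric]) (auto simp: case_prod_unfold)
  finally show ?thesis .
qed

text \<open>Reversing all arcs turns heads into tails; grouping by tail then yields the degree
  weights.\<close>

lemma sum_arcs_snd: "(\<Sum>(u, v)\<in>R. f v) = (\<Sum>v\<in>V. real (deg v) * f v)"
proof -
  have "(\<Sum>(u, v)\<in>R. f v) = (\<Sum>(v, u)\<in>R. f v)"
    by (rule sum.reindex_bij_witness[where i = prod.swap and j = prod.swap])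
      (use symR in \<open>auto dest: symD\<close>)
  also have "R = Sigma V (\<lambda>v. R `` {v})" using RV by auto
  then have "(\<Sum>(v, u)\<in>R. f v) = (\<Sum>(v, u)\<in>Sigma V (\<lambda>v. R `` {v}). f v)" by simp
  also have "\<dots> = (\<Sum>v\<in>V. real (deg v) * f v)"
    using finV fin_nbrs by (subst sum.Sigma[symmetric]) auto
  finally show ?thesis .
qed

end

section \<open>Concavity and convexity inequalities\<close>

lemma sum_ln_le:
  fixes f :: "'a \<Rightarrow> real"
  assumes "finite A" "A \<noteq> {}" "\<And>x. x \<in> A \<Longrightarrow> f x > 0"
  shows "(\<Sum>x\<in>A. ln (f x)) \<le> real (card A) * ln ((\<Sum>x\<in>A. f x) / real (card A))"
proof -
  define a where "a = (\<Sum>x\<in>A. f x) / real (card A)"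
  have c: "real (card A) > 0" using assms by (simp add: card_gt_0_iff)
  have a: "a > 0" using assms c by (auto simp: a_def intro!: divide_pos_pos sum_pos)
  \<comment> \<open>The graph of \<open>ln\<close> lies below its tangent at the mean
    \<open>a\<close>; the linear corrections sum to zero.\<close>
  have "ln (f x) \<le> ln a + (f x / a - 1)" if "x \<in> A" for x
    using ln_le_minus_one[of "f x / a"] a assms(3)[OF that] by (simp add: ln_div)
  then have "(\<Sum>x\<in>A. ln (f x)) \<le> (\<Sum>x\<in>A. ln a + (f x / a - 1))" by (rule sum_mono)
  also have "\<dots> = real (card A) * ln a + ((\<Sum>x\<in>A. f x) / a - real (card A))"
    by (simp add: sum.distrib sum_subtractf sum_divide_distrib)
  also have "(\<Sum>x\<in>A. f x) / a = real (card A)" using a c by (simp add: a_def field_simps)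
  finally show ?thesis by (simp add: a_def)
qed

text \<open>The second derivative \<open>(x - 2) / (x - 1)\<^sup>2\<close> is nonnegative from 2 on,
  which is why minimum degree two is arranged.\<close>

lemma convex_on_mult_ln: "convex_on {2..} (\<lambda>x::real. x * ln (x - 1))"
proof (rule f''_ge0_imp_convex)
  fix x :: real assume x: "x \<in> {2..}"
  show "((\<lambda>x. x * ln (x - 1)) has_real_derivative (ln (x - 1) + x / (x - 1))) (at x)"
    using x by (auto intro!: derivative_eq_intros)
  show "((\<lambda>x. ln (x - 1) + x / (x - 1)) has_real_derivative ((x - 2) / (x - 1)\<^sup>2)) (at x)"
  proof -
    define y where "y = x - 1"
    have y: "y > 0" "x = y + 1" using x by (auto simp: y_def)
    then have "1 / y = y / y\<^sup>2" by (simp add: power2_eq_square)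
    then have "1 / y + (y - x) / y\<^sup>2 = (x - 2) / y\<^sup>2"
      using y by (simp add: diff_divide_distrib)
    then show ?thesis
      using x by (auto simp: y_def power2_eq_square intro!: derivative_eq_intros)
  qed
  show "(x - 2) / (x - 1)\<^sup>2 \<ge> 0" using x by simp
qed simp

section \<open>The Moore bound for minimum degree two\<close>

locale min_degree_two_graph = finite_graph +
  assumes V_nonempty: "V \<noteq> {}" and deg2: "\<And>v. v \<in> V \<Longrightarrow> 2 \<le> deg v"
begin

text \<open>By symmetry \<open>u\<close> is itself a neighbour of \<open>v\<close>, so forbidding
  the return removes exactly one choice and leaves at least one.\<close>

lemma deg_arc:
  assumes "(u, v) \<in> R"
  shows "2 \<le> deg v" "real (card (R `` {v} - {u})) = real (deg v) - 1" "R `` {v} - {u} \<noteq> {}"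
proof -
  show 2: "2 \<le> deg v" using assms RV deg2 by auto
  have "(v, u) \<in> R" using assms symR by (auto dest: symD)
  then have c: "card (R `` {v} - {u}) = deg v - 1" by (simp add: fin_nbrs)
  then show "real (card (R `` {v} - {u})) = real (deg v) - 1" using 2 by simp
  show "R `` {v} - {u} \<noteq> {}" using c 2 by force
qed

lemma num_ext_ge_1: "(u, v) \<in> R \<Longrightarrow> 1 \<le> num_ext R i u v"
proof (induction i arbitrary: u v)
  case (Suc i)
  have "1 \<le> (\<Sum>w\<in>R `` {v} - {u}. 1 :: real)" using deg_arc[OF Suc.prems] by simp
  also have "\<dots> \<le> (\<Sum>w\<in>R `` {v} - {u}. num_ext R i v w)"
    by (rule sum_mono) (use Suc.IH in auto)
  finally show ?case using num_ext_Suc[OF Suc.prems] by simp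
qed (simp add: num_ext_0)

lemma sum_card_deg: "(\<Sum>v\<in>V. real (deg v)) = real (card R)"
  using sum_arcs_snd[of "\<lambda>_. 1"] by simp

lemma avg_deg_ge_2: "2 \<le> real (card R) / real (card V)"
proof -
  have "2 * real (card V) = (\<Sum>v\<in>V. 2)" by simp
  also have "\<dots> \<le> (\<Sum>v\<in>V. real (deg v))" by (rule sum_mono) (use deg2 in force)
  finally show ?thesis
    using sum_card_deg V_nonempty finV by (simp add: field_simps card_gt_0_iff)
qed

text \<open>Summing over arcs weights each head by its degree. Jensen is therefore applied over
  vertices to \<open>x * ln (x - 1)\<close>, which is convex, and not to the concave
  \<open>ln (x - 1)\<close>.\<close>

lemma sum_ln_deg_ge:
  "real (card R) * ln (real (card R) / real (card V) - 1) \<le> (\<Sum>(u, v)\<in>R. ln (real (deg v) - 1))"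
proof -
  let ?c = "real (card V)"
  have c: "?c > 0" using V_nonempty finV by (simp add: card_gt_0_iff)
  have avg: "(\<Sum>v\<in>V. (1 / ?c) *\<^sub>R real (deg v)) = real (card R) / ?c"
    using sum_card_deg by (simp flip: sum_divide_distrib)
  have "(real (card R) / ?c) * ln (real (card R) / ?c - 1) \<le>
    (\<Sum>v\<in>V. (1 / ?c) * (real (deg v) * ln (real (deg v) - 1)))"
    using convex_on_sum[OF finV V_nonempty convex_on_mult_ln,
        of "\<lambda>_. 1 / ?c" "\<lambda>v. real (deg v)"] c deg2 unfolding avg by force
  also have "\<dots> = (\<Sum>v\<in>V. real (deg v) * ln (real (deg v) - 1)) / ?c"
    by (simp add: sum_divide_distrib)
  finally show ?thesis using c sum_arcs_snd[of "\<lambda>v. ln (real (deg v) - 1)"]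
    by (simp add: field_simps)
qed

lemma sum_ln_num_ext_Suc:
  "(\<Sum>(u, v)\<in>R. ln (num_ext R (Suc i) u v)) \<ge>
   (\<Sum>(u, v)\<in>R. ln (real (deg v) - 1)) + (\<Sum>(u, v)\<in>R. ln (num_ext R i u v))"
proof -
  \<comment> \<open>The divisor is the number of choices after an arc into \<open>v\<close>. Since
    \<open>?g\<close> depends on \<open>v\<close> and \<open>w\<close> only,
    \<open>sum_steps\<close> applies to it.\<close>
  let ?g = "\<lambda>v w. ln (num_ext R i v w) / (real (deg v) - 1)"
  have step: "ln (real (deg v) - 1) + (\<Sum>w\<in>R `` {v} - {u}. ?g v w) \<le> ln (num_ext R (Suc i) u v)"
    if uv: "(u, v) \<in> R" for u v
  proof -
    note d = deg_arc[OF uv]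
    have d1: "real (deg v) - 1 > 0" using d(1) by simp
    have pos: "num_ext R i v w > 0" if "w \<in> R `` {v} - {u}" for w
      using num_ext_ge_1[of v w i] that by auto
    have "(\<Sum>w\<in>R `` {v} - {u}. ln (num_ext R i v w)) \<le>
      (real (deg v) - 1) * ln (num_ext R (Suc i) u v / (real (deg v) - 1))"
      using sum_ln_le[OF finite_Diff[OF fin_nbrs] d(3) pos] d(2) num_ext_Suc[OF uv] by simp
    then have "(\<Sum>w\<in>R `` {v} - {u}. ?g v w) \<le> ln (num_ext R (Suc i) u v / (real (deg v) - 1))"
      using d1 by (simp add: sum_divide_distrib[symmetric] divide_le_eq mult.commute)
    also have "\<dots> = ln (num_ext R (Suc i) u v) - ln (real (deg v) - 1)"
      using d1 num_ext_ge_1[OF uv, of "Suc i"] by (simp add: ln_div)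
    finally show ?thesis by simp
  qed
  \<comment> \<open>An arc \<open>(v, w)\<close> has \<open>deg v - 1\<close> non-backtracking
    predecessors, which cancels the divisor.\<close>
  have "(\<Sum>u\<in>R `` {v} - {w}. ?g v w) = ln (num_ext R i v w)" if "(v, w) \<in> R" for v w
    using deg_arc[of w v] that symR by (auto dest: symD)
  then have "(\<Sum>(u, v)\<in>R. ln (num_ext R i u v)) = (\<Sum>(u, v)\<in>R. \<Sum>w\<in>R `` {v} - {u}. ?g v w)"
    unfolding sum_steps by (intro sum.cong) auto
  then have "(\<Sum>(u, v)\<in>R. ln (real (deg v) - 1)) + (\<Sum>(u, v)\<in>R. ln (num_ext R i u v)) =
    (\<Sum>(u, v)\<in>R. ln (real (deg v) - 1) + (\<Sum>w\<in>R `` {v} - {u}. ?g v w))"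
    by (simp add: sum.distrib case_prod_unfold)
  also have "\<dots> \<le> (\<Sum>(u, v)\<in>R. ln (num_ext R (Suc i) u v))"
    by (rule sum_mono) (use step in auto)
  finally show ?thesis .
qed

lemma sum_num_ext_ge:
  "real (card R) * (real (card R) / real (card V) - 1) ^ i \<le> (\<Sum>(u, v)\<in>R. num_ext R i u v)"
proof -
  define b where "b = real (card R) / real (card V) - 1"
  have b: "b \<ge> 1" using avg_deg_ge_2 by (simp add: b_def)
  define a where "a = b ^ i"
  have a: "a > 0" using b by (simp add: a_def)
  have "real (card R) * (real i * ln b) \<le> (\<Sum>(u, v)\<in>R. ln (num_ext R i u v))"
  proof (induction i)
    case 0
    have "(\<Sum>(u, v)\<in>R. ln (num_ext R 0 u v)) = 0" by (rule sum.neutral) (auto simp: num_ext_0)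
    then show ?case by simp
  next
    case (Suc i)
    then show ?case using sum_ln_num_ext_Suc[of i] sum_ln_deg_ge
      by (simp add: b_def[symmetric] algebra_simps)
  qed
  then have "real (card R) * ln a \<le> (\<Sum>(u, v)\<in>R. ln (num_ext R i u v))"
    using b by (simp add: a_def ln_realpow)
  then have "0 \<le> a * (\<Sum>(u, v)\<in>R. ln (num_ext R i u v) - ln a)"
    using a by (simp add: sum_subtractf case_prod_unfold)
  \<comment> \<open>This prepares the tangent of \<open>ln\<close> at \<open>a\<close>: for positive
    \<open>N\<close>, \<open>a * (1 + ln (N / a)) \<le> N\<close>. It turns the bound on the mean
    logarithm into one on the mean.\<close>
  then have "real (card R) * a \<le> (\<Sum>(u, v)\<in>R. a * (1 + (ln (num_ext R i u v) - ln a)))"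
    by (simp add: sum.distrib case_prod_unfold distrib_left sum_distrib_left)
  also have "\<dots> \<le> (\<Sum>(u, v)\<in>R. num_ext R i u v)"
  proof (rule sum_mono, clarify)
    fix u v assume "(u, v) \<in> R"
    then have "num_ext R i u v > 0" using num_ext_ge_1[of u v i] by simp
    then have "1 + (ln (num_ext R i u v) - ln a) \<le> num_ext R i u v / a"
      using ln_le_minus_one[of "num_ext R i u v / a"] a by (simp add: ln_div)
    then show "a * (1 + (ln (num_ext R i u v) - ln a)) \<le> num_ext R i u v"
      using a by (simp add: pos_le_divide_eq mult.commute)
  qed
  finally show ?thesis by (simp add: a_def b_def)
qed

text \<open>Sum \<open>sum_num_ext_le\<close> over all arcs; reversal makes both directions
  contribute equally.\<close>

lemma moore_bound_min_degree_two:
  assumes "girth_gt R (2 * l + 1)"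
  shows "2 * (\<Sum>i\<le>l. (real (card R) / real (card V) - 1) ^ i) \<le> real (card V)"
proof -
  let ?b = "real (card R) / real (card V) - 1"
  have swap: "(\<Sum>(u, v)\<in>R. num_ext R i v u) = (\<Sum>(u, v)\<in>R. num_ext R i u v)" for i
    by (rule sum.reindex_bij_witness[where i = prod.swap and j = prod.swap])
      (use symR in \<open>auto dest: symD\<close>)
  have "real (card R) * (2 * (\<Sum>i\<le>l. ?b ^ i)) = 2 * (\<Sum>i\<le>l. real (card R) * ?b ^ i)"
    by (simp add: sum_distrib_left mult.left_commute)
  also have "\<dots> \<le> 2 * (\<Sum>i\<le>l. \<Sum>(u, v)\<in>R. num_ext R i u v)"
    by (intro mult_left_mono sum_mono sum_num_ext_ge) simp
  also have "\<dots> = (\<Sum>i\<le>l. \<Sum>(u, v)\<in>R. num_ext R i u v) + (\<Sum>i\<le>l. \<Sum>(u, v)\<in>R. num_ext R i v u)"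
    by (simp add: swap)
  also have "\<dots> = (\<Sum>(u, v)\<in>R. (\<Sum>i\<le>l. num_ext R i u v) + (\<Sum>i\<le>l. num_ext R i v u))"
    by (simp add: case_prod_unfold sum.distrib sum.swap[of _ R])
  also have "\<dots> \<le> (\<Sum>(u, v)\<in>R. real (card V))"
    by (rule sum_mono) (use sum_num_ext_le[OF assms] in auto)
  also have "\<dots> = real (card R) * real (card V)" by simp
  finally have "real (card R) * (2 * (\<Sum>i\<le>l. ?b ^ i)) \<le> real (card R) * real (card V)" .
  moreover have "real (card R) > 0" using avg_deg_ge_2 by (cases "card R = 0") auto
  ultimately show ?thesis by (simp only: mult_le_cancel_left_pos)
qed

end

section \<open>Removing vertices of degree at most one\<close>

lemma girth_gt_mono:
  assumes "girth_gt R m" "S \<subseteq> R"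
  shows "girth_gt S m"
  unfolding girth_gt_def
proof (intro allI impI notI)
  fix xs assume xs: "distinct xs" "3 \<le> length xs" "length xs \<le> m"
    "successively (\<lambda>x y. (x, y) \<in> S) xs" "(last xs, hd xs) \<in> S"
  have "successively (\<lambda>x y. (x, y) \<in> R) xs"
    using xs(4) by (rule successively_mono) (use assms(2) in auto)
  then show False using assms xs unfolding girth_gt_def by blast
qed

theorem moore_bound:
  assumes "finite_graph V R" "girth_gt R (2 * l + 1)" "V \<noteq> {}" "2 * card V \<le> card R"
  shows "2 * (\<Sum>i\<le>l. (real (card R) / real (card V) - 1) ^ i) \<le> real (card V)"
  using assms
proof (induction "card V" arbitrary: V R rule: less_induct)
  case less
  interpret finite_graph V R by fact
  show ?case
  proof (cases "\<forall>v\<in>V. 2 \<le> deg v")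
    case True
    then interpret min_degree_two_graph V R using less.prems by unfold_locales auto
    show ?thesis using less.prems by (intro moore_bound_min_degree_two)
  next
    case False
    then obtain v where v: "v \<in> V" "deg v \<le> 1" by auto
    define V' where "V' = V - {v}"
    define R' where "R' = R \<inter> V' \<times> V'"
    have cV: "card V = Suc (card V')" using v finV unfolding V'_def by (metis card_Suc_Diff1)
    \<comment> \<open>The lost arcs leave or enter \<open>v\<close>, at most one of each
      kind.\<close>
    have "R \<subseteq> R' \<union> (Pair v ` (R `` {v}) \<union> (\<lambda>u. (u, v)) ` (R `` {v}))"
      using RV symR by (auto simp: R'_def V'_def dest: symD)
    then have "card R \<le> card (R' \<union> (Pair v ` (R `` {v}) \<union> (\<lambda>u. (u, v)) ` (R `` {v})))"
      using finR fin_nbrs by (intro card_mono) (auto simp: R'_def)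
    also have "\<dots> \<le> card R' + (card (Pair v ` (R `` {v})) + card ((\<lambda>u. (u, v)) ` (R `` {v})))"
      by (intro order.trans[OF card_Un_le] add_left_mono card_Un_le)
    also have "\<dots> \<le> card R' + (deg v + deg v)"
      by (intro add_left_mono add_mono card_image_le fin_nbrs)
    finally have cR: "card R \<le> card R' + 2" using v by simp
    have ge: "2 * card V' \<le> card R'" using cR cV less.prems by simp
    have "V' \<noteq> {}"
    proof
      assume "V' = {}"
      then have "V = {v}" using v by (auto simp: V'_def)
      then have "R = {}" using RV irreflR by (auto simp: irrefl_def)
      then show False using less.prems finV by simp
    qed
    moreover have "finite_graph V' R'"
      using finV symR irreflR by unfold_locales (auto simp: V'_def R'_def sym_def irrefl_def)
    moreover have "girth_gt R' (2 * l + 1)"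
      using less.prems(2) by (rule girth_gt_mono) (auto simp: R'_def)
    ultimately have IH: "2 * (\<Sum>i\<le>l. (real (card R') / real (card V') - 1) ^ i) \<le> real (card V')"
      using ge cV by (intro less.hyps) auto
    have c': "real (card V') > 0" using \<open>V' \<noteq> {}\<close> finV by (simp add: V'_def card_gt_0_iff)
    have rV: "real (card V) = real (card V') + 1" using cV by simp
    \<comment> \<open>Expanded, this is exactly \<open>2 * card V \<le> card R\<close>: from average
      degree at least two, losing one vertex and at most two arcs cannot lower the average.\<close>
    have "real (card R) * real (card V') \<le> (real (card R) - 2) * (real (card V') + 1)"
      using less.prems(4) rV by (simp add: algebra_simps)
    also have "\<dots> \<le> real (card R') * (real (card V') + 1)"
      using cR by (intro mult_right_mono) auto
    finally have mono: "real (card R) / real (card V) \<le> real (card R') / real (card V')"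
      using c' rV by (simp add: field_simps)
    have "real (card R) / real (card V) - 1 \<ge> 0"
      using less.prems(4) rV c' by (simp add: field_simps)
    then have "(\<Sum>i\<le>l. (real (card R) / real (card V) - 1) ^ i) \<le>
      (\<Sum>i\<le>l. (real (card R') / real (card V') - 1) ^ i)"
      using mono by (intro sum_mono power_mono) auto
    then show ?thesis using IH rV by linarith
  qed
qed

section \<open>Application to bipartite graphs without short even cycles\<close>

lemma (in pair_graph) finite_graph: "finite_graph (pverts G) (parcs G)"
  by unfold_locales
    (auto simp: sym_def irrefl_def dest: in_arcsD1 in_arcsD2 arcs_symmetric no_loops')

text \<open>Each edge has two opposite arcs above it, distinct because there are no loops.\<close>

lemma (in pair_graph) two_card_edges_le: "2 * card (edges G) \<le> card (parcs G)"
proof -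
  interpret fg: finite_graph "pverts G" "parcs G" by (rule finite_graph)
  let ?f = "\<lambda>(u, v). {u, v}"
  have "2 \<le> card {a \<in> parcs G. ?f a = e}" if "e \<in> edges G" for e
  proof -
    from that obtain u v where uv: "(u, v) \<in> parcs G" "e = {u, v}" by (auto simp: edges_def)
    then have "{(u, v), (v, u)} \<subseteq> {a \<in> parcs G. ?f a = e}" using fg.symR by (auto dest: symD)
    moreover have "u \<noteq> v" using uv fg.irreflR by (auto simp: irrefl_def)
    moreover have "finite {a \<in> parcs G. ?f a = e}" using fg.finR by simp
    ultimately show ?thesis
      using card_mono[of "{a \<in> parcs G. ?f a = e}" "{(u, v), (v, u)}"] by simp
  qed
  then have "(\<Sum>e\<in>edges G. 2) \<le> (\<Sum>e\<in>edges G. card {a \<in> parcs G. ?f a = e})"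
    by (rule sum_mono)
  also have "\<dots> = card (parcs G)"
    using sum.image_gen[OF fg.finR, of "\<lambda>_. 1::nat" ?f] by (simp add: edges_def)
  finally show ?thesis by simp
qed

text \<open>Sides alternate along a cycle, so its length is even; the even lengths from 3 to
  \<open>2 * l + 1\<close> are the forbidden 4, 6, ..., \<open>2 * l\<close>.\<close>

lemma bipartite_girth_gt:
  fixes G :: "'a pair_pre_digraph"
  assumes "pair_graph G" "bipartite G" "family_free (even_cycles l) G"
  shows "girth_gt (parcs G) (2 * l + 1)"
  unfolding girth_gt_def
proof (intro allI impI notI)
  fix xs assume xs: "distinct xs" "3 \<le> length xs" "length xs \<le> 2 * l + 1"
    "successively (\<lambda>x y. (x, y) \<in> parcs G) xs" and closed: "(last xs, hd xs) \<in> parcs G"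
  interpret pair_graph G by fact
  interpret fg: finite_graph "pverts G" "parcs G" by (rule finite_graph)
  let ?k = "length xs"
  have arc: "(xs ! i, xs ! (Suc i mod ?k)) \<in> parcs G" if "i < ?k" for i
  proof (cases "Suc i < ?k")
    case True
    then show ?thesis using xs(4) by (simp add: successively_conv_nth)
  next
    case False
    then have i: "Suc i = ?k" using that by simp
    then have "xs ! i = last xs" by (metis diff_Suc_1 last_conv_nth list.size(3) nat.distinct(1))
    moreover have "xs ! 0 = hd xs" using that by (metis hd_conv_nth length_0_conv not_less_zero)
    ultimately show ?thesis using closed i by simp
  qed
  obtain U W where UW: "U \<inter> W = {}" "parcs G \<subseteq> U \<times> W \<union> W \<times> U"
    using assms(2) by (auto simp: bipartite_def)
  then have flip: "u \<in> U \<longleftrightarrow> v \<notin> U" if "(u, v) \<in> parcs G" for u v using that by blast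
  have col: "i < ?k \<Longrightarrow> (xs ! i \<in> U \<longleftrightarrow> (xs ! 0 \<in> U \<longleftrightarrow> even i))" for i
  proof (induction i)
    case (Suc i)
    then show ?case using flip[OF arc[of i]] by auto
  qed simp
  obtain j where j: "?k = Suc j" using xs(2) by (cases ?k) auto
  \<comment> \<open>The closing arc runs from index \<open>j\<close> to index 0 and changes sides,
    so \<open>j\<close> is odd.\<close>
  have "even ?k" using flip[OF arc[of j]] col[of j] j by auto
  then obtain m where m: "?k = 2 * m" by auto
  have arcs: "(xs ! u, xs ! v) \<in> parcs G" if "(u, v) \<in> parcs (cycle_graph ?k)" for u v
    using that arc[of u] arc[of v] fg.symR by (auto simp: cycle_graph_def dest: symD)
  have "contains_graph G (cycle_graph ?k)"
    unfolding contains_graph_iff[OF assms(1) pair_graph_cycle_graph[OF xs(2)]]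
  proof (intro exI[of _ "(!) xs"] conjI)
    show "inj_on ((!) xs) (pverts (cycle_graph ?k))"
      using xs(1) by (auto simp: cycle_graph_def inj_on_def nth_eq_iff_index_eq)
    show "(!) xs ` pverts (cycle_graph ?k) \<subseteq> pverts G"
      using arc fg.RV by (auto simp: cycle_graph_def)
  qed (use arcs in auto)
  moreover have "cycle_graph ?k \<in> even_cycles l"
    using m xs(2,3) by (auto simp: even_cycles_def)
  ultimately show False using assms(3) by (auto simp: family_free_def)
qed

theorem proposition1p4:
  fixes l n :: nat and q :: real
  assumes "l \<ge> 2"
    and "q > 0"
    and "real n = 2 * (\<Sum>i\<le>l. q ^ i)"
  shows "real (zarankiewicz n (even_cycles l)) \<le> 1 / 2 * (q + 1) * real n"
proof -
  \<comment> \<open>The maximum is attained, so it suffices to bound the edges of one extremal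
    graph.\<close>
  have "zarankiewicz n (even_cycles l) \<in> zarankiewicz_sizes n (even_cycles l)"
    unfolding zarankiewicz_def
    by (rule Max_in[OF finite_zarankiewicz_sizes zarankiewicz_sizes_even_cycles_nonempty])
  then obtain G :: "nat pair_pre_digraph" where G: "pair_graph G" "card (pverts G) = n"
    "bipartite G" "family_free (even_cycles l) G"
    and z: "zarankiewicz n (even_cycles l) = card (edges G)"
    by (auto simp: zarankiewicz_sizes_def)
  interpret pair_graph G by fact
  define r where "r = card (parcs G)"
  have er: "2 * real (card (edges G)) \<le> real r" using two_card_edges_le by (simp add: r_def)
  have "0 < (\<Sum>i\<le>l. q ^ i)" using assms(2) by (intro sum_pos) auto
  then have n0: "real n > 0" using assms(3) by simp
  have "real (card (edges G)) \<le> (q + 1) * real n / 2"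
  proof (cases "2 * n \<le> r")
    case True
    have ne: "pverts G \<noteq> {}" using n0 G(2) by auto
    have moore: "2 * (\<Sum>i\<le>l. (real r / real n - 1) ^ i) \<le> real n"
      using moore_bound[OF finite_graph bipartite_girth_gt[OF G(1,3,4)] ne] True G(2)
      by (simp add: r_def)
    have "real r / real n - 1 \<le> q"
    proof (rule ccontr)
      assume "\<not> real r / real n - 1 \<le> q"
      \<comment> \<open>The term \<open>i = 1\<close> increases strictly, the others weakly.\<close>
      then have "(\<Sum>i\<le>l. q ^ i) < (\<Sum>i\<le>l. (real r / real n - 1) ^ i)"
        using assms(1,2) by (intro sum_strict_mono_ex1 ballI bexI[of _ 1] power_mono) auto
      then show False using moore assms(3) by simp
    qed
    then have "real r \<le> (q + 1) * real n" using n0 by (simp add: field_simps)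
    then show ?thesis using er by simp
  next
    case False
    then have "card (edges G) + 1 \<le> n" using two_card_edges_le by (simp add: r_def)
    then have "real (card (edges G)) \<le> real n - 1" by linarith
    \<comment> \<open>By the geometric sum the left side is \<open>2 * (1 - q ^ Suc l)\<close>; the
      inequality rearranges to \<open>n - 1 \<le> (q + 1) * n / 2\<close>.\<close>
    moreover have "real n * (1 - q) \<le> 2"
    proof -
      have "(1 - q) * (\<Sum>i\<le>l. q ^ i) = 1 - q ^ Suc l"
        using sum_gp_basic[of q l] by simp
      then show ?thesis using assms(2,3) by (simp add: mult.commute mult.left_commute)
    qed
    ultimately show ?thesis by (simp add: algebra_simps)
  qed
  then show ?thesis by (simp add: z)
qed

end
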